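(* Let $X$ be a nonempty second-countable Hausdorff space which is strongly nonadhesive, and let $S$ be a proper dyadic subbase of $X$. Then: (1) $L(D_S)$ has enough minimal elements and $\min(L(D_S))$ is compact. (2) $L(\widehat{D}_S)$ has enough minimal elements and $\min(L(\widehat{D}_S))$ is compact.
   Context: A Hausdorff space is adhesive if it has at least two points and the closures of any two non-empty open sets have non-empty intersection; it is nonadhesive if it is not adhesive; it is strongly nonadhesive if every open subspace is nonadhesive. $\mathbb{T}=\{0,1,\bot\}$ is ordered by $\bot\sqsubseteq 0$, $\bot\sqsubseteq 1$, and $\mathbb{T}^\omega$ (infinite sequences over $\mathbb{T}$) carries the product order $\sqsubseteq$. For $p\in\mathbb{T}^\omega$, $\mathrm{dom}(p)=\{k: p(k)\neq\bot\}$; $\mathbb{T}^*$ is the set of $p\in\mathbb{T}^\omega$ with $\mathrm{dom}(p)$ finite. For $m\in\mathbb{N}$, $p|_m\in\mathbb{T}^*$ is defined by $p|_m(k)=p(k)$ if $k<m$ and $p|_m(k)=\bot$ if $k\ge m$. A dyadic subbase of $X$ is a family $S=\{S_{n,a}: n\in\mathbb{N}, a\in\{0,1\}\}$ of regular open sets (open sets equal to the interior of their closure) that forms a subbase of $X$ and such that $S_{n,1}$ is the exterior (complement of the closure) of $S_{n,0}$ for each $n$. Put $S_{n,\bot}=X\setminus(S_{n,0}\cup S_{n,1})$. For $x\in X$, $\tilde{x}\in\mathbb{T}^\omega$ is given by $\tilde{x}(n)=c$ iff $x\in S_{n,c}$ ($c\in\mathbb{T}$), and $\widetilde{X}=\{\tilde{x}:x\in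 X\}$. For $p\in\mathbb{T}^\omega$, $S(p)=\bigcap_{k\in\mathrm{dom}(p)}S_{k,p(k)}$ and $\bar{S}(p)=\bigcap_{k\in\mathrm{dom}(p)}\mathrm{cl}\,S_{k,p(k)}$ (empty intersection is $X$). $S$ is proper if $\mathrm{cl}\,S(e)=\bar{S}(e)$ for every $e\in\mathbb{T}^*$. Let $\uparrow\widetilde{X}=\{p\in\mathbb{T}^\omega: p\sqsupseteq\tilde{x}\text{ for some }x\in X\}$. Define the posets $K_S=\{p|_m:p\in\widetilde{X},m\in\mathbb{N}\}$ and $\widehat{K}_S=\{p|_m:p\in\uparrow\widetilde{X},m\in\mathbb{N}\}$ (subsets of $\mathbb{T}^*$), and let $D_S=\mathrm{Idl}(K_S)$, $\widehat{D}_S=\mathrm{Idl}(\widehat{K}_S)$ be their ideal completions (ideals, i.e. directed downwards-closed subsets, ordered by inclusion), with the Scott topology. Via $I\mapsto\bigsqcup I$ (supremum in $\mathbb{T}^\omega$) they are regarded as subposets of $\mathbb{T}^\omega$; the sets of compact elements are $K_S$ and $\widehat{K}_S$. For a domain (an $\omega$-algebraic pointed dcpo) $D$, $L(D)$ denotes the set of non-compact elements, with the subspace topology. For a poset $P$, $\min(P)$ is the set of minimal elements of $P$; $P$ has enough minimal elements if for all $y\in P$ there is $x\in\min(P)$ with $x\sqsubseteq y$. *)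

theory Defs
  imports "HOL-Analysis.Analysis"
begin

section \<open>Adhesive spaces\<close>

definition adhesive_space :: "'a topology \<Rightarrow> bool" where
  "adhesive_space X \<longleftrightarrow>
     Hausdorff_space X \<and>
     (\<exists>x\<in>topspace X. \<exists>y\<in>topspace X. x \<noteq> y) \<and>
     (\<forall>U V. openin X U \<and> openin X V \<and> U \<noteq> {} \<and> V \<noteq> {}
        \<longrightarrow> X closure_of U \<inter> X closure_of V \<noteq> {})"

definition strongly_nonadhesive_space :: "'a topology \<Rightarrow> bool" where
  "strongly_nonadhesive_space X \<longleftrightarrow>
     (\<forall>U. openin X U \<longrightarrow> \<not> adhesive_space (subtopology X U))"


section \<open>Ideal completion, Scott topology, compact and minimal elements\<close>

definition directed_under :: "('b \<Rightarrow> 'b \<Rightarrow> bool) \<Rightarrow> 'b set \<Rightarrow> bool" where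
  "directed_under le A \<longleftrightarrow> A \<noteq> {} \<and> (\<forall>x\<in>A. \<forall>y\<in>A. \<exists>z\<in>A. le x z \<and> le y z)"

definition Idl :: "('b \<Rightarrow> 'b \<Rightarrow> bool) \<Rightarrow> 'b set \<Rightarrow> 'b set set" where
  "Idl le P =
     {I. I \<subseteq> P \<and> directed_under le I \<and> (\<forall>x\<in>I. \<forall>y\<in>P. le y x \<longrightarrow> y \<in> I)}"

text \<open>In what follows a poset is a subset \<open>D\<close> of a type of class \<open>order\<close>, and suprema are taken
  within \<open>D\<close>. For \<open>D = Idl le P\<close> the order of the type is inclusion.\<close>

definition is_sup_in :: "'b::order set \<Rightarrow> 'b set \<Rightarrow> 'b \<Rightarrow> bool" where
  "is_sup_in D A s \<longleftrightarrow>
     s \<in> D \<and> (\<forall>a\<in>A. a \<le> s) \<and> (\<forall>u\<in>D. (\<forall>a\<in>A. a \<le> u) \<longrightarrow> s \<le> u)"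

definition scott_open_in :: "'b::order set \<Rightarrow> 'b set \<Rightarrow> bool" where
  "scott_open_in D U \<longleftrightarrow>
     U \<subseteq> D \<and>
     (\<forall>x\<in>U. \<forall>y\<in>D. x \<le> y \<longrightarrow> y \<in> U) \<and>
     (\<forall>A s. A \<subseteq> D \<and> directed_under (\<le>) A \<and> is_sup_in D A s \<and> s \<in> U \<longrightarrow> A \<inter> U \<noteq> {})"

definition scott_topology :: "'b::order set \<Rightarrow> 'b topology" where
  "scott_topology D = topology (scott_open_in D)"

lemma scott_open_in_upward: "scott_open_in D U \<Longrightarrow> x \<in> U \<Longrightarrow> y \<in> D \<Longrightarrow> x \<le> y \<Longrightarrow> y \<in> U"
  unfolding scott_open_in_def by simp

lemma scott_open_in_directed:
  assumes "scott_open_in D U" "A \<subseteq> D" "directed_under (\<le>) A" "is_sup_in D A s" "s \<in> U"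
  obtains a where "a \<in> A" "a \<in> U"
proof -
  have "A \<inter> U \<noteq> {}" using assms unfolding scott_open_in_def by metis
  then show ?thesis using that by auto
qed

lemma istopology_scott_open_in: "istopology (scott_open_in D)"
  unfolding istopology_def
proof (intro conjI allI impI)
  fix U V assume U: "scott_open_in D U" and V: "scott_open_in D V"
  show "scott_open_in D (U \<inter> V)"
    unfolding scott_open_in_def[of D "U \<inter> V"]
  proof (intro conjI allI impI ballI)
    show "U \<inter> V \<subseteq> D" using U by (auto simp: scott_open_in_def)
  next
    fix x y assume *: "x \<in> U \<inter> V" "y \<in> D" "x \<le> y"
    then show "y \<in> U \<inter> V"
      using scott_open_in_upward[OF U, of x y] scott_open_in_upward[OF V, of x y] by simp
  next
    fix A s
    assume "A \<subseteq> D \<and> directed_under (\<le>) A \<and> is_sup_in D A s \<and> s \<in> U \<inter> V"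
    then have A: "A \<subseteq> D" "directed_under (\<le>) A" "is_sup_in D A s" "s \<in> U" "s \<in> V" by auto
    obtain a where a: "a \<in> A" "a \<in> U" by (rule scott_open_in_directed[OF U A(1-4)])
    obtain b where b: "b \<in> A" "b \<in> V" by (rule scott_open_in_directed[OF V A(1-3,5)])
    obtain c where c: "c \<in> A" "a \<le> c" "b \<le> c"
      using A(2) a(1) b(1) unfolding directed_under_def by meson
    have "c \<in> D" using A(1) c(1) by auto
    then have "c \<in> U" "c \<in> V"
      using scott_open_in_upward[OF U a(2) _ c(2)] scott_open_in_upward[OF V b(2) _ c(3)] by auto
    then show "A \<inter> (U \<inter> V) \<noteq> {}" using c(1) by auto
  qed
next
  fix \<K> assume K: "\<forall>U\<in>\<K>. scott_open_in D U"
  show "scott_open_in D (\<Union>\<K>)"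
    unfolding scott_open_in_def[of D "\<Union>\<K>"]
  proof (intro conjI allI impI ballI)
    show "\<Union>\<K> \<subseteq> D" using K by (auto simp: scott_open_in_def)
  next
    fix x y assume *: "x \<in> \<Union>\<K>" "y \<in> D" "x \<le> y"
    then obtain U where U: "U \<in> \<K>" "x \<in> U" by auto
    then show "y \<in> \<Union>\<K>" using scott_open_in_upward[of D U x y] K * by auto
  next
    fix A s
    assume "A \<subseteq> D \<and> directed_under (\<le>) A \<and> is_sup_in D A s \<and> s \<in> \<Union>\<K>"
    then obtain U where A: "A \<subseteq> D" "directed_under (\<le>) A" "is_sup_in D A s" "s \<in> U" and U: "U \<in> \<K>"
      by auto
    obtain a where "a \<in> A" "a \<in> U" by (rule scott_open_in_directed[OF bspec[OF K U] A])
    then show "A \<inter> \<Union>\<K> \<noteq> {}" using U by auto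
  qed
qed

lemma openin_scott_topology: "openin (scott_topology D) U \<longleftrightarrow> scott_open_in D U"
  unfolding scott_topology_def by (simp add: istopology_scott_open_in topology_inverse')

lemma topspace_scott_topology: "topspace (scott_topology D) = D"
proof -
  have "A \<inter> D \<noteq> {}" if "A \<subseteq> D" "directed_under (\<le>) A" for A
    using that unfolding directed_under_def by (simp add: inf.absorb1)
  then have "scott_open_in D D"
    unfolding scott_open_in_def by simp
  then show ?thesis
    unfolding topspace_def openin_scott_topology by (auto simp: scott_open_in_def)
qed

definition compact_elements :: "'b::order set \<Rightarrow> 'b set" where
  "compact_elements D =
     {k \<in> D. \<forall>A s. A \<subseteq> D \<and> directed_under (\<le>) A \<and> is_sup_in D A s \<and> k \<le> s
               \<longrightarrow> (\<exists>a\<in>A. k \<le> a)}"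

definition noncompact_elements :: "'b::order set \<Rightarrow> 'b set" where
  "noncompact_elements D = D - compact_elements D"

definition L_space :: "'b::order set \<Rightarrow> 'b topology" where
  "L_space D = subtopology (scott_topology D) (noncompact_elements D)"

definition minimal_elements :: "'b::order set \<Rightarrow> 'b set" where
  "minimal_elements P = {x \<in> P. \<forall>y\<in>P. y \<le> x \<longrightarrow> y = x}"

definition enough_minimal_elements :: "'b::order set \<Rightarrow> bool" where
  "enough_minimal_elements P \<longleftrightarrow> (\<forall>y\<in>P. \<exists>x\<in>minimal_elements P. x \<le> y)"


section \<open>Dyadic subbases and the associated domains\<close>

text \<open>An element \<open>p\<close> of $\mathbb{T}^\omega$ is a partial map \<open>nat \<rightharpoonup> bool\<close>: \<open>None\<close> stands for $\bot$, and
  \<open>False\<close>, \<open>True\<close> for the digits 0, 1. The product order is \<open>(\<subseteq>\<^sub>m)\<close>, and the truncation of \<open>p\<close>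
  at \<open>m\<close> is \<open>p |` {..<m}\<close>.\<close>

type_synonym tseq = "nat \<rightharpoonup> bool"

definition regular_openin :: "'a topology \<Rightarrow> 'a set \<Rightarrow> bool" where
  "regular_openin X U \<longleftrightarrow> openin X U \<and> X interior_of (X closure_of U) = U"

definition dyadic_subbase :: "'a topology \<Rightarrow> (nat \<Rightarrow> bool \<Rightarrow> 'a set) \<Rightarrow> bool" where
  "dyadic_subbase X S \<longleftrightarrow>
     (\<forall>n a. regular_openin X (S n a)) \<and>
     topology (arbitrary union_of
       (finite intersection_of (\<lambda>U. \<exists>n a. U = S n a) relative_to topspace X)) = X \<and>
     (\<forall>n. S n True = topspace X - X closure_of (S n False))"

text \<open>\<open>S n False\<close> and \<open>S n True\<close> are disjoint in a dyadic subbase, so the order of the tests below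
  is immaterial; \<open>None\<close> arises exactly on the complement of \<open>S n False \<union> S n True\<close>.\<close>

definition tcode :: "(nat \<Rightarrow> bool \<Rightarrow> 'a set) \<Rightarrow> 'a \<Rightarrow> tseq" where
  "tcode S x = (\<lambda>n. if x \<in> S n False then Some False
                   else if x \<in> S n True then Some True else None)"

definition codes :: "'a topology \<Rightarrow> (nat \<Rightarrow> bool \<Rightarrow> 'a set) \<Rightarrow> tseq set" where
  "codes X S = tcode S ` topspace X"

definition up_codes :: "'a topology \<Rightarrow> (nat \<Rightarrow> bool \<Rightarrow> 'a set) \<Rightarrow> tseq set" where
  "up_codes X S = {p. \<exists>q\<in>codes X S. q \<subseteq>\<^sub>m p}"

definition S_cell :: "'a topology \<Rightarrow> (nat \<Rightarrow> bool \<Rightarrow> 'a set) \<Rightarrow> tseq \<Rightarrow> 'a set" where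
  "S_cell X S p = topspace X \<inter> (\<Inter>k\<in>dom p. S k (the (p k)))"

definition S_cell_bar :: "'a topology \<Rightarrow> (nat \<Rightarrow> bool \<Rightarrow> 'a set) \<Rightarrow> tseq \<Rightarrow> 'a set" where
  "S_cell_bar X S p = topspace X \<inter> (\<Inter>k\<in>dom p. X closure_of (S k (the (p k))))"

definition proper_dyadic_subbase :: "'a topology \<Rightarrow> (nat \<Rightarrow> bool \<Rightarrow> 'a set) \<Rightarrow> bool" where
  "proper_dyadic_subbase X S \<longleftrightarrow>
     dyadic_subbase X S \<and>
     (\<forall>e. finite (dom e) \<longrightarrow> X closure_of (S_cell X S e) = S_cell_bar X S e)"

definition K_poset :: "'a topology \<Rightarrow> (nat \<Rightarrow> bool \<Rightarrow> 'a set) \<Rightarrow> tseq set" where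
  "K_poset X S = {p |` {..<m} | p m. p \<in> codes X S}"

definition K_hat_poset :: "'a topology \<Rightarrow> (nat \<Rightarrow> bool \<Rightarrow> 'a set) \<Rightarrow> tseq set" where
  "K_hat_poset X S = {p |` {..<m} | p m. p \<in> up_codes X S}"

text \<open>The domains consist of the ideals themselves. Their suprema in $\mathbb{T}^\omega$ give an order
  isomorphic copy inside $\mathbb{T}^\omega$, so minimality, compactness and the Scott topology agree.\<close>

definition D_domain :: "'a topology \<Rightarrow> (nat \<Rightarrow> bool \<Rightarrow> 'a set) \<Rightarrow> tseq set set" where
  "D_domain X S = Idl (\<subseteq>\<^sub>m) (K_poset X S)"

definition D_hat_domain :: "'a topology \<Rightarrow> (nat \<Rightarrow> bool \<Rightarrow> 'a set) \<Rightarrow> tseq set set" where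
  "D_hat_domain X S = Idl (\<subseteq>\<^sub>m) (K_hat_poset X S)"

end

theory Submission
  imports Defs
begin

text \<open>Both domains are ideal completions of the poset of all truncations of sequences from a set
  \<open>C\<close>, where \<open>C\<close> is the set of codes or its upward closure. Give the set of partial sequences the
  product of the discrete topologies on the three values, and let \<open>branches C\<close> be the closure of
  \<open>C\<close> in this compact space. The argument rests on one property of \<open>C\<close>, called \<open>escapes C\<close> below:
  no finite partial sequence is the truncation at \<open>m\<close> of a member of \<open>C\<close> for arbitrarily large \<open>m\<close>.

  The property holds for codes for a topological reason (\<open>escapes_codes\<close>). If \<open>e\<close> is the truncation
  of the code of \<open>x\<close> at a large \<open>m\<close>, then \<open>x\<close> lies in the open cell \<open>S(e)\<close> and on the boundary of
  every early \<open>S\<^sub>k\<close> with \<open>k\<close> outside the domain of \<open>e\<close>. Strong nonadhesiveness leaves two cases.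
  Either \<open>S(e)\<close> has at most one point, which is then isolated and has a total code; or \<open>S(e)\<close>
  contains two nonempty open sets with disjoint closures in \<open>S(e)\<close>. In the second case each of them
  contains a nonempty cell \<open>S(d)\<close>; for large \<open>m\<close> the point \<open>x\<close> belongs to \<open>S\<close>-bar\<open>(d)\<close>, which is the
  closure of \<open>S(d)\<close> by properness, so \<open>x\<close> is in both closures, a contradiction. Since a finite partial
  sequence has only finitely many lower bounds, the property passes to the upward closure
  (\<open>escapes_up_closure\<close>).

  Given the property, \<open>p \<mapsto> {e. e \<sqsubseteq> p}\<close> is an order isomorphism from \<open>branches C\<close> onto the noncompact
  ideals (\<open>noncompact_elements_eq_branches\<close>, \<open>below_branch_le_iff\<close>). Without it a limit of branches
  could be a finite sequence, that is, a compact element. Being closed in the product, the set of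
  branches is stable under infima of chains, so Zorn's lemma yields minimal elements below every
  element. It is also compact, and the isomorphism is continuous into the Scott topology, so the
  space of all noncompact elements is compact. Scott open sets being upward closed, a family that
  covers the minimal elements covers all noncompact elements, so the minimal ones form a compact
  set.\<close>

section \<open>Sets of partial sequences and their branches\<close>

text \<open>All finite truncations of members of \<open>C\<close>; this is the common form of \<open>K_poset\<close> and
  \<open>K_hat_poset\<close>.\<close>

definition truncations :: "tseq set \<Rightarrow> tseq set" where
  "truncations C = {p |` {..<m} | p m. p \<in> C}"

text \<open>The sequences all of whose truncations at \<open>m\<close> agree with the truncation at the same \<open>m\<close> of a
  member of \<open>C\<close>; this is the closure of \<open>C\<close> in the product of discrete spaces. Merely asking that
  every truncation lie in \<open>truncations C\<close> would be weaker, since a finite sequence does not record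
  where it was cut off.\<close>

definition branches :: "tseq set \<Rightarrow> tseq set" where
  "branches C = {p. \<forall>m. \<exists>q\<in>C. p |` {..<m} = q |` {..<m}}"

text \<open>The part of \<open>K\<close> below \<open>p\<close>: the ideal that represents \<open>p\<close> in the ideal completion of \<open>K\<close>.\<close>

definition below :: "tseq set \<Rightarrow> tseq \<Rightarrow> tseq set" where
  "below K p = {e \<in> K. e \<subseteq>\<^sub>m p}"

text \<open>Every finite partial sequence is eventually avoided, uniformly over \<open>C\<close>: it is not a
  truncation of a member of \<open>C\<close> at any sufficiently large index.\<close>

definition escapes :: "tseq set \<Rightarrow> bool" where
  "escapes C \<longleftrightarrow> (\<forall>e. finite (dom e) \<longrightarrow> (\<exists>m. \<forall>m'\<ge>m. \<forall>p\<in>C. p |` {..<m'} \<noteq> e))"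

lemma escapes_subset: "escapes C \<Longrightarrow> B \<subseteq> C \<Longrightarrow> escapes B"
  unfolding escapes_def by (meson subsetD)

lemma restrict_map_le: "p |` A \<subseteq>\<^sub>m p"
  by (auto simp: map_le_def restrict_map_def)

lemma restrict_lessThan_eq_iff:
  "p |` {..<m::nat} = q |` {..<m} \<longleftrightarrow> (\<forall>k<m. p k = q k)"
  by (auto simp: fun_eq_iff restrict_map_def)

lemma map_le_restrict: "e \<subseteq>\<^sub>m p \<Longrightarrow> dom e \<subseteq> A \<Longrightarrow> e \<subseteq>\<^sub>m p |` A"
  by (auto simp: map_le_def restrict_map_def)

lemma finite_dom_bound:
  assumes "finite (dom (e::tseq))"
  obtains m where "dom e \<subseteq> {..<m}"
proof -
  obtain m where "\<forall>k\<in>dom e. k < m"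
    using finite_nat_set_iff_bounded assms by auto
  then have "dom e \<subseteq> {..<m}" by auto
  then show ?thesis by (rule that)
qed

lemma truncations_finite: "e \<in> truncations C \<Longrightarrow> finite (dom e)"
  by (auto simp: truncations_def)

lemma branch_truncation: "p \<in> branches C \<Longrightarrow> p |` {..<m} \<in> truncations C"
  unfolding branches_def truncations_def by blast

lemma below_mono: "p \<subseteq>\<^sub>m q \<Longrightarrow> below K p \<subseteq> below K q"
  unfolding below_def by (auto intro: map_le_trans)

lemma below_branch_le_iff:
  assumes "p \<in> branches C"
  shows "below (truncations C) p \<subseteq> below (truncations C) q \<longleftrightarrow> p \<subseteq>\<^sub>m q"
proof
  assume sub: "below (truncations C) p \<subseteq> below (truncations C) q"
  have "p |` {..<m} \<subseteq>\<^sub>m q" for m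
    using sub branch_truncation[OF assms, of m] restrict_map_le[of p "{..<m}"]
    unfolding below_def by blast
  then have "p k = q k" if "k \<in> dom p" for k
    using that unfolding map_le_def by (metis dom_restrict IntI lessThan_iff lessI restrict_in)
  then show "p \<subseteq>\<^sub>m q" by (simp add: map_le_def)
qed (rule below_mono)

section \<open>Noncompact ideals are branches\<close>

lemma below_truncation_ideal:
  assumes "e \<in> K"
  shows "below K e \<in> Idl (\<subseteq>\<^sub>m) K"
  using assms unfolding Idl_def below_def directed_under_def
  by (auto intro: map_le_trans)

lemma below_branch_ideal:
  assumes "p \<in> branches C"
  shows "below (truncations C) p \<in> Idl (\<subseteq>\<^sub>m) (truncations C)"
proof -
  have mem: "p |` {..<m} \<in> below (truncations C) p" for m
    using branch_truncation[OF assms] restrict_map_le unfolding below_def by blast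
  have "\<exists>z\<in>below (truncations C) p. x \<subseteq>\<^sub>m z \<and> y \<subseteq>\<^sub>m z"
    if "x \<in> below (truncations C) p" "y \<in> below (truncations C) p" for x y
  proof -
    have fin: "finite (dom x)" "finite (dom y)" and le: "x \<subseteq>\<^sub>m p" "y \<subseteq>\<^sub>m p"
      using that truncations_finite by (auto simp: below_def)
    obtain m where "dom x \<subseteq> {..<m}" using fin(1) by (rule finite_dom_bound)
    moreover obtain n where "dom y \<subseteq> {..<n}" using fin(2) by (rule finite_dom_bound)
    ultimately have "dom x \<subseteq> {..<max m n}" "dom y \<subseteq> {..<max m n}" by fastforce+
    then show ?thesis using mem[of "max m n"] map_le_restrict le by blast
  qed
  then show ?thesis
    using mem[of 0] unfolding Idl_def directed_under_def
    by (auto simp: below_def intro: map_le_trans)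
qed

lemma Union_directed_ideal:
  assumes A: "A \<subseteq> Idl le K" and dir: "directed_under (\<subseteq>) A"
  shows "\<Union>A \<in> Idl le K"
proof -
  have ideal: "I \<subseteq> K" "directed_under le I" "\<And>x y. x \<in> I \<Longrightarrow> y \<in> K \<Longrightarrow> le y x \<Longrightarrow> y \<in> I"
    if "I \<in> A" for I
    using that A by (auto simp: Idl_def)
  obtain I where "I \<in> A" using dir by (auto simp: directed_under_def)
  then have "\<Union>A \<noteq> {}" using ideal(2) by (auto simp: directed_under_def)
  moreover have "\<exists>z\<in>\<Union>A. le x z \<and> le y z" if x: "x \<in> \<Union>A" and y: "y \<in> \<Union>A" for x y
  proof -
    obtain I J where "I \<in> A" "x \<in> I" "J \<in> A" "y \<in> J" using x y by auto
    then obtain L where L: "L \<in> A" "x \<in> L" "y \<in> L"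
      using dir unfolding directed_under_def by (meson subsetD)
    then obtain z where "z \<in> L" "le x z" "le y z"
      using ideal(2)[OF L(1)] unfolding directed_under_def by meson
    then show ?thesis using L(1) by blast
  qed
  ultimately have "directed_under le (\<Union>A)" by (simp add: directed_under_def)
  moreover have "\<Union>A \<subseteq> K" using ideal(1) by blast
  moreover have "\<forall>x\<in>\<Union>A. \<forall>y\<in>K. le y x \<longrightarrow> y \<in> \<Union>A" using ideal(3) by blast
  ultimately show ?thesis by (simp add: Idl_def)
qed

lemma below_element_compact:
  assumes "e \<in> K"
  shows "below K e \<in> compact_elements (Idl (\<subseteq>\<^sub>m) K)"
  unfolding compact_elements_def
proof (intro CollectI conjI allI impI)
  show "below K e \<in> Idl (\<subseteq>\<^sub>m) K" by (rule below_truncation_ideal[OF assms])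
  fix A s
  assume A: "A \<subseteq> Idl (\<subseteq>\<^sub>m) K \<and> directed_under (\<subseteq>) A
    \<and> is_sup_in (Idl (\<subseteq>\<^sub>m) K) A s \<and> below K e \<subseteq> s"
  then have "\<Union>A \<in> Idl (\<subseteq>\<^sub>m) K" using Union_directed_ideal by blast
  then have "s \<subseteq> \<Union>A" using A unfolding is_sup_in_def by blast
  moreover have "e \<in> below K e" using assms by (simp add: below_def)
  ultimately obtain a where a: "a \<in> A" "e \<in> a" using A by blast
  then have "below K e \<subseteq> a" using A unfolding Idl_def below_def by blast
  then show "\<exists>a\<in>A. below K e \<subseteq> a" using a by blast
qed

text \<open>The ideal of a branch is the directed supremum of the principal ideals of its truncations.\<close>

lemma below_branch_sup:
  assumes "p \<in> branches C"
  defines "A \<equiv> range (\<lambda>m. below (truncations C) (p |` {..<m}))"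
  shows "A \<subseteq> Idl (\<subseteq>\<^sub>m) (truncations C)" and "directed_under (\<subseteq>) A"
    and "is_sup_in (Idl (\<subseteq>\<^sub>m) (truncations C)) A (below (truncations C) p)"
proof -
  show "A \<subseteq> Idl (\<subseteq>\<^sub>m) (truncations C)"
    unfolding A_def using branch_truncation[OF assms(1)] below_truncation_ideal by blast
  have mono: "below (truncations C) (p |` {..<m}) \<subseteq> below (truncations C) (p |` {..<n})"
    if "m \<le> n" for m n
    using that by (intro below_mono) (auto simp: map_le_def restrict_map_def)
  show "directed_under (\<subseteq>) A"
    unfolding directed_under_def A_def using mono
    by (auto, metis max.cobounded1 max.cobounded2)
  have "below (truncations C) p \<subseteq> \<Union>A"
  proof
    fix e assume e: "e \<in> below (truncations C) p"
    then have "finite (dom e)" using truncations_finite by (auto simp: below_def)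
    then obtain m where "dom e \<subseteq> {..<m}" by (rule finite_dom_bound)
    then have "e \<in> below (truncations C) (p |` {..<m})"
      using e map_le_restrict by (auto simp: below_def)
    then show "e \<in> \<Union>A" by (auto simp: A_def)
  qed
  moreover have "a \<subseteq> below (truncations C) p" if "a \<in> A" for a
    using that below_mono[OF restrict_map_le] unfolding A_def by blast
  ultimately show "is_sup_in (Idl (\<subseteq>\<^sub>m) (truncations C)) A (below (truncations C) p)"
    unfolding is_sup_in_def using below_branch_ideal[OF assms(1)] by blast
qed

text \<open>If the ideal of \<open>p\<close> were compact, it would be principal and \<open>p\<close> a finite sequence, so \<open>p\<close>
  would be a truncation of members of \<open>C\<close> at arbitrarily large indices.\<close>

lemma below_branch_noncompact:
  assumes "escapes C" "p \<in> branches C"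
  shows "below (truncations C) p \<in> noncompact_elements (Idl (\<subseteq>\<^sub>m) (truncations C))"
proof -
  have "below (truncations C) p \<notin> compact_elements (Idl (\<subseteq>\<^sub>m) (truncations C))"
  proof
    assume "below (truncations C) p \<in> compact_elements (Idl (\<subseteq>\<^sub>m) (truncations C))"
    then obtain m where "below (truncations C) p \<subseteq> below (truncations C) (p |` {..<m})"
      unfolding compact_elements_def using below_branch_sup[OF assms(2)] by blast
    then have "p \<subseteq>\<^sub>m p |` {..<m}" using below_branch_le_iff[OF assms(2)] by blast
    then have eq: "p = p |` {..<m}" using restrict_map_le map_le_antisym by blast
    then have "finite (dom p)" by (metis dom_restrict finite_Int finite_lessThan)
    then obtain n where n: "\<And>n' q. n' \<ge> n \<Longrightarrow> q \<in> C \<Longrightarrow> q |` {..<n'} \<noteq> p"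
      using assms(1) unfolding escapes_def by blast
    obtain q where "q \<in> C" "p |` {..<max m n} = q |` {..<max m n}"
      using assms(2) unfolding branches_def by blast
    moreover have "p |` {..<max m n} = p"
      by (subst (1 2) eq) (auto simp: fun_eq_iff restrict_map_def)
    ultimately show False using n[of "max m n" q] by simp
  qed
  then show ?thesis using below_branch_ideal[OF assms(2)] by (simp add: noncompact_elements_def)
qed

text \<open>A noncompact ideal \<open>I\<close> has no greatest element. Its union \<open>p\<close> is a branch: for given \<open>m\<close>, some
  element of \<open>I\<close> agrees with \<open>p\<close> below \<open>m\<close> and has a defined entry at or beyond \<open>m\<close>, so the member
  of \<open>C\<close> that it truncates is cut off after \<open>m\<close> and agrees with \<open>p\<close> below \<open>m\<close>.\<close>

lemma noncompact_is_below_branch: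
  assumes I: "I \<in> noncompact_elements (Idl (\<subseteq>\<^sub>m) (truncations C))"
  obtains p where "p \<in> branches C" "I = below (truncations C) p"
proof -
  let ?K = "truncations C"
  have sub: "I \<subseteq> ?K" and dir: "directed_under (\<subseteq>\<^sub>m) I"
    and down: "\<And>x y. x \<in> I \<Longrightarrow> y \<in> ?K \<Longrightarrow> y \<subseteq>\<^sub>m x \<Longrightarrow> y \<in> I"
    and nc: "I \<notin> compact_elements (Idl (\<subseteq>\<^sub>m) ?K)"
    using I by (auto simp: noncompact_elements_def Idl_def)
  have no_max: "\<exists>d\<in>I. \<not> d \<subseteq>\<^sub>m e" if "e \<in> I" for e
  proof (rule ccontr)
    assume "\<not> (\<exists>d\<in>I. \<not> d \<subseteq>\<^sub>m e)"
    then have "I = below ?K e" using sub down that unfolding below_def by blast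
    then show False using nc below_element_compact that sub by blast
  qed
  \<comment> \<open>The union of the partial sequences in \<open>I\<close>; directedness makes the choice irrelevant.\<close>
  define p :: tseq where "p k = (if \<exists>e\<in>I. k \<in> dom e then (SOME e. e \<in> I \<and> k \<in> dom e) k else None)" for k
  have upper: "e \<subseteq>\<^sub>m p" if e: "e \<in> I" for e
    unfolding map_le_def
  proof
    fix k assume k: "k \<in> dom e"
    define d where "d = (SOME e. e \<in> I \<and> k \<in> dom e)"
    have d: "d \<in> I \<and> k \<in> dom d" unfolding d_def by (rule someI[of _ e]) (use e k in blast)
    then obtain c where "d \<subseteq>\<^sub>m c" "e \<subseteq>\<^sub>m c"
      using dir e unfolding directed_under_def by blast
    then have "e k = d k" using k d by (simp add: map_le_def)
    moreover have "p k = d k" unfolding p_def d_def[symmetric] using e k by auto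
    ultimately show "e k = p k" by simp
  qed
  have approx: "\<exists>e\<in>I. p |` {..<m} \<subseteq>\<^sub>m e" for m
  proof (induction m)
    case 0
    then show ?case using dir by (auto simp: directed_under_def)
  next
    case (Suc m)
    then obtain e where e: "e \<in> I" "p |` {..<m} \<subseteq>\<^sub>m e" by blast
    obtain d where d: "d \<in> I" "m \<in> dom p \<longrightarrow> m \<in> dom d"
    proof (cases "m \<in> dom p")
      case True
      then have "\<exists>d\<in>I. m \<in> dom d" unfolding p_def dom_def by (auto split: if_splits)
      then show ?thesis using that by blast
    qed (use e in \<open>auto intro: that\<close>)
    obtain c where c: "c \<in> I" "e \<subseteq>\<^sub>m c" "d \<subseteq>\<^sub>m c"
      using dir e d unfolding directed_under_def by blast
    have "(p |` {..<Suc m}) k = c k" if "k \<in> dom (p |` {..<Suc m})" for k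
    proof (cases "k < m")
      case True
      then have "k \<in> dom (p |` {..<m})" using that by auto
      then have "(p |` {..<m}) k = c k"
        using map_le_trans[OF e(2) c(2)] unfolding map_le_def by blast
      then show ?thesis using True by simp
    next
      case False
      then have "k = m" "m \<in> dom p" using that by (auto simp: less_Suc_eq)
      then have "k \<in> dom c" using c(3) d(2) map_le_implies_dom_le by blast
      then have "p k = c k" using upper[OF c(1)] by (simp only: map_le_def)
      then show ?thesis using that by (auto simp: restrict_map_def)
    qed
    then show ?case using c(1) by (auto simp: map_le_def)
  qed
  have "p \<in> branches C"
    unfolding branches_def
  proof (intro CollectI allI)
    fix m
    obtain e where e: "e \<in> I" "p |` {..<m} \<subseteq>\<^sub>m e" using approx by blast
    obtain d where d: "d \<in> I" "\<not> d \<subseteq>\<^sub>m e" using no_max e(1) by blast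
    obtain c where c: "c \<in> I" "e \<subseteq>\<^sub>m c" "d \<subseteq>\<^sub>m c"
      using dir e(1) d(1) unfolding directed_under_def by blast
    have "\<not> dom c \<subseteq> {..<m}"
    proof
      assume "dom c \<subseteq> {..<m}"
      then have "c \<subseteq>\<^sub>m e" using map_le_restrict[OF upper[OF c(1)]] e(2) map_le_trans by blast
      then show False using c(3) d(2) map_le_trans by blast
    qed
    moreover obtain q n where q: "q \<in> C" "c = q |` {..<n}"
      using c(1) sub unfolding truncations_def by blast
    ultimately have "m < n" by auto
    have "p k = c k" if "k < m" for k
    proof (cases "k \<in> dom p")
      case True
      then have "(p |` {..<m}) k = c k"
        using that map_le_trans[OF e(2) c(2)] by (auto simp only: map_le_def dom_restrict)
      then show ?thesis using that by simp
    next
      case False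
      then show ?thesis using upper[OF c(1)] by (metis domIff map_le_def)
    qed
    then have "p |` {..<m} = q |` {..<m}"
      unfolding restrict_lessThan_eq_iff using q(2) \<open>m < n\<close> by simp
    then show "\<exists>q\<in>C. p |` {..<m} = q |` {..<m}" using q(1) by blast
  qed
  moreover have "I = below ?K p"
  proof
    show "I \<subseteq> below ?K p" using upper sub by (auto simp: below_def)
    show "below ?K p \<subseteq> I"
    proof
      fix e assume e: "e \<in> below ?K p"
      then have "finite (dom e)" using truncations_finite by (auto simp: below_def)
      then obtain m where "dom e \<subseteq> {..<m}" by (rule finite_dom_bound)
      then have "e \<subseteq>\<^sub>m p |` {..<m}" using e map_le_restrict by (auto simp: below_def)
      then obtain d where "d \<in> I" "e \<subseteq>\<^sub>m d" using approx map_le_trans by blast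
      then show "e \<in> I" using down e by (auto simp: below_def)
    qed
  qed
  ultimately show ?thesis using that by blast
qed

lemma noncompact_elements_eq_branches:
  assumes "escapes C"
  shows "noncompact_elements (Idl (\<subseteq>\<^sub>m) (truncations C)) = below (truncations C) ` branches C"
  using below_branch_noncompact[OF assms] noncompact_is_below_branch by blast

section \<open>Minimal branches\<close>

text \<open>The infimum of a chain of branches agrees on each finite set of indices with some element of
  the chain, hence is a branch.\<close>

lemma branches_chain_lower_bound:
  assumes P: "P \<subseteq> branches C" "P \<noteq> {}"
    and chain: "\<And>p q. p \<in> P \<Longrightarrow> q \<in> P \<Longrightarrow> p \<subseteq>\<^sub>m q \<or> q \<subseteq>\<^sub>m p"
  obtains r where "r \<in> branches C" "\<And>p. p \<in> P \<Longrightarrow> r \<subseteq>\<^sub>m p"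
proof -
  obtain p0 where p0: "p0 \<in> P" using P(2) by blast
  \<comment> \<open>In a chain all defined entries at \<open>k\<close> coincide, so the value may be read off from \<open>p0\<close>.\<close>
  define r :: tseq where "r k = (if \<forall>p\<in>P. k \<in> dom p then p0 k else None)" for k
  have lower: "r \<subseteq>\<^sub>m p" if "p \<in> P" for p
    unfolding map_le_def
  proof
    fix k assume "k \<in> dom r"
    then have "r k = p0 k" "k \<in> dom p" "k \<in> dom p0"
      using that p0 by (auto simp: r_def domIff split: if_splits)
    then show "r k = p k" using chain[OF that p0] unfolding map_le_def by metis
  qed
  have "\<exists>p\<in>P. \<forall>k<m. r k = p k" for m
  proof (induction m)
    case 0
    then show ?case using p0 by auto
  next
    case (Suc m)
    then obtain p where p: "p \<in> P" "\<forall>k<m. r k = p k" by blast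
    obtain q where q: "q \<in> P" "r m = q m"
    proof (cases "\<forall>p\<in>P. m \<in> dom p")
      case True
      then show ?thesis using that[OF p0] by (simp add: r_def)
    next
      case False
      then obtain q where "q \<in> P" "m \<notin> dom q" by blast
      moreover have "r m = None" using False unfolding r_def by (rule if_not_P)
      ultimately show ?thesis using that[of q] by (simp add: domIff)
    qed
    from chain[OF p(1) q(1)] show ?case
    proof
      assume "p \<subseteq>\<^sub>m q"
      then have "r m = p m" using lower[OF p(1)] q by (metis domIff map_le_def)
      then show ?thesis using p by (auto simp: less_Suc_eq)
    next
      assume "q \<subseteq>\<^sub>m p"
      then have "r k = q k" if "k < m" for k
        using lower[OF q(1)] p(2) that by (metis domIff map_le_def)
      then show ?thesis using q by (auto simp: less_Suc_eq)
    qed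
  qed
  then have "r \<in> branches C"
    using P(1) unfolding branches_def restrict_lessThan_eq_iff
    by (smt (verit, best) mem_Collect_eq subsetD)
  then show ?thesis using lower that by blast
qed

lemma minimal_branch_below:
  assumes "p \<in> branches C"
  obtains q where "q \<in> branches C" "q \<subseteq>\<^sub>m p" "\<And>r. r \<in> branches C \<Longrightarrow> r \<subseteq>\<^sub>m q \<Longrightarrow> r = q"
proof -
  let ?A = "{q \<in> branches C. q \<subseteq>\<^sub>m p}" and ?R = "\<lambda>a b. b \<subseteq>\<^sub>m a"
  have po: "partial_order_on ?A (relation_of ?R ?A)"
    by (rule partial_order_on_relation_ofI) (auto intro: map_le_trans map_le_antisym)
  have "\<exists>u\<in>?A. \<forall>a\<in>P. u \<subseteq>\<^sub>m a" if P: "P \<in> Chains (relation_of ?R ?A)" for P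
  proof (cases "P = {}")
    case True
    then show ?thesis using assms by auto
  next
    case False
    have sub: "P \<subseteq> ?A" and chain: "\<And>a b. a \<in> P \<Longrightarrow> b \<in> P \<Longrightarrow> a \<subseteq>\<^sub>m b \<or> b \<subseteq>\<^sub>m a"
      using P unfolding Chains_def relation_of_def by auto
    have "P \<subseteq> branches C" using sub by auto
    then obtain r where r: "r \<in> branches C" "\<And>a. a \<in> P \<Longrightarrow> r \<subseteq>\<^sub>m a"
      using branches_chain_lower_bound False chain by blast
    then have "r \<subseteq>\<^sub>m p" using False sub map_le_trans by blast
    then show ?thesis using r by blast
  qed
  then obtain q where "q \<in> ?A" "\<forall>a\<in>?A. a \<subseteq>\<^sub>m q \<longrightarrow> a = q"
    using predicate_Zorn[OF po] by blast
  then show ?thesis using that map_le_trans by blast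
qed

lemma enough_minimal_noncompact:
  assumes "escapes C"
  shows "enough_minimal_elements (noncompact_elements (Idl (\<subseteq>\<^sub>m) (truncations C)))"
  unfolding enough_minimal_elements_def noncompact_elements_eq_branches[OF assms]
proof
  fix I assume "I \<in> below (truncations C) ` branches C"
  then obtain p where p: "p \<in> branches C" "I = below (truncations C) p" by blast
  obtain q where q: "q \<in> branches C" "q \<subseteq>\<^sub>m p" "\<And>r. r \<in> branches C \<Longrightarrow> r \<subseteq>\<^sub>m q \<Longrightarrow> r = q"
    using minimal_branch_below[OF p(1)] by blast
  then have "below (truncations C) q \<in> minimal_elements (below (truncations C) ` branches C)"
    unfolding minimal_elements_def using below_branch_le_iff by blast
  then show "\<exists>J\<in>minimal_elements (below (truncations C) ` branches C). J \<subseteq> I"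
    using below_mono[OF q(2)] p(2) by blast
qed

section \<open>Compactness\<close>

text \<open>The compact space of partial sequences; undefined is here an isolated third value.\<close>

abbreviation seq_space :: "tseq topology" where
  "seq_space \<equiv> product_topology (\<lambda>_. discrete_topology UNIV) UNIV"

lemma openin_cylinder: "openin seq_space {q. \<forall>k<m. q k = p k}"
proof -
  have "openin seq_space (Pi\<^sub>E UNIV (\<lambda>k. if k < m then {p k} else UNIV))"
    by (rule product_topology_basis) (auto intro: finite_subset[of _ "{..<m}"])
  also have "Pi\<^sub>E UNIV (\<lambda>k. if k < m then {p k} else UNIV) = {q. \<forall>k<m. q k = p k}"
    by (auto simp: PiE_iff split: if_splits)
  finally show ?thesis .
qed

lemma compactin_branches: "compactin seq_space (branches C)"
proof -
  have "openin seq_space (UNIV - branches C)"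
  proof (subst openin_subopen, intro ballI)
    fix p assume "p \<in> UNIV - branches C"
    then obtain m where m: "\<not> (\<exists>q\<in>C. \<forall>k<m. p k = q k)"
      unfolding branches_def restrict_lessThan_eq_iff by blast
    have "{q. \<forall>k<m. q k = p k} \<subseteq> UNIV - branches C"
    proof
      fix q assume q: "q \<in> {q. \<forall>k<m. q k = p k}"
      have "q \<notin> branches C"
      proof
        assume "q \<in> branches C"
        then obtain c where "c \<in> C" "\<forall>k<m. q k = c k"
          unfolding branches_def restrict_lessThan_eq_iff by blast
        then show False using m q by auto
      qed
      then show "q \<in> UNIV - branches C" by simp
    qed
    then show "\<exists>T. openin seq_space T \<and> p \<in> T \<and> T \<subseteq> UNIV - branches C"
      using openin_cylinder[of m p] by blast
  qed
  then have "closedin seq_space (branches C)" by (simp add: closedin_def)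
  moreover have "compact_space seq_space"
    by (simp add: compact_space_product_topology compact_space_discrete_topology)
  ultimately show ?thesis by (simp add: closedin_compact_space)
qed

lemma continuous_below:
  assumes "escapes C"
  shows "continuous_map (subtopology seq_space (branches C))
    (L_space (Idl (\<subseteq>\<^sub>m) (truncations C))) (below (truncations C))"
proof -
  let ?D = "Idl (\<subseteq>\<^sub>m) (truncations C)" and ?J = "below (truncations C)"
  have "openin (subtopology seq_space (branches C)) {p \<in> branches C. ?J p \<in> W}"
    if W: "scott_open_in ?D W" for W
  proof (subst openin_subopen, intro ballI)
    fix p assume "p \<in> {p \<in> branches C. ?J p \<in> W}"
    then have p: "p \<in> branches C" "?J p \<in> W" by auto
    obtain m where m: "?J (p |` {..<m}) \<in> W"
      using scott_open_in_directed[OF W below_branch_sup[OF p(1)] p(2)] by blast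
    let ?T = "branches C \<inter> {q. \<forall>k<m. q k = p k}"
    have "?J q \<in> W" if "q \<in> ?T" for q
    proof -
      have "p |` {..<m} \<subseteq>\<^sub>m q"
        using that by (auto simp: map_le_def restrict_map_def)
      then show ?thesis
        using scott_open_in_upward[OF W m below_branch_ideal below_mono] that by blast
    qed
    moreover have "openin (subtopology seq_space (branches C)) ?T"
      using openin_cylinder by (rule openin_subtopology_Int2)
    ultimately show "\<exists>T. openin (subtopology seq_space (branches C)) T \<and> p \<in> T
        \<and> T \<subseteq> {p \<in> branches C. ?J p \<in> W}"
      using p(1) by (intro exI[of _ ?T]) auto
  qed
  then have "continuous_map (subtopology seq_space (branches C)) (scott_topology ?D) ?J"
    unfolding continuous_map openin_scott_topology topspace_scott_topology
    using below_branch_ideal by (auto simp: image_subset_iff)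
  then show ?thesis
    unfolding L_space_def noncompact_elements_eq_branches[OF assms] by (auto simp: continuous_map_in_subtopology)
qed

lemma compactin_minimal_noncompact:
  assumes "escapes C"
  defines "D \<equiv> Idl (\<subseteq>\<^sub>m) (truncations C)"
  shows "compactin (L_space D) (minimal_elements (noncompact_elements D))"
proof -
  let ?N = "noncompact_elements D"
  have N: "topspace (L_space D) = ?N"
    by (auto simp: L_space_def topspace_scott_topology noncompact_elements_def)
  have "compactin (L_space D) (below (truncations C) ` branches C)"
    unfolding D_def using _ continuous_below[OF assms(1)]
    by (rule image_compactin) (simp add: compactin_subtopology compactin_branches)
  then have comp: "compactin (L_space D) ?N"
    unfolding D_def noncompact_elements_eq_branches[OF assms(1)] .
  show ?thesis
    unfolding compactin_def
  proof (intro conjI allI impI)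
    show "minimal_elements ?N \<subseteq> topspace (L_space D)"
      unfolding N by (auto simp: minimal_elements_def)
    fix \<U> assume U: "(\<forall>U\<in>\<U>. openin (L_space D) U) \<and> minimal_elements ?N \<subseteq> \<Union>\<U>"
    have "?N \<subseteq> \<Union>\<U>"
    proof
      fix I assume I: "I \<in> ?N"
      then obtain J where J: "J \<in> minimal_elements ?N" "J \<subseteq> I"
        using enough_minimal_noncompact[OF assms(1)]
        unfolding enough_minimal_elements_def D_def by blast
      then obtain U where "U \<in> \<U>" "J \<in> U" using U by blast
      moreover from this obtain W where "scott_open_in D W" "U = W \<inter> ?N"
        using U unfolding L_space_def openin_subtopology openin_scott_topology by blast
      moreover have "I \<in> D" using I by (simp add: noncompact_elements_def)
      ultimately show "I \<in> \<Union>\<U>" using scott_open_in_upward[of D W J I] I J(2) by blast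
    qed
    then obtain \<F> where "finite \<F>" "\<F> \<subseteq> \<U>" "?N \<subseteq> \<Union>\<F>"
      using comp U unfolding compactin_def by meson
    moreover have "minimal_elements ?N \<subseteq> ?N" by (auto simp: minimal_elements_def)
    ultimately show "\<exists>\<F>. finite \<F> \<and> \<F> \<subseteq> \<U> \<and> minimal_elements ?N \<subseteq> \<Union>\<F>"
      by blast
  qed
qed

section \<open>Codes of a strongly nonadhesive space\<close>

lemma dyadic_disjoint:
  assumes "dyadic_subbase X S"
  shows "S n False \<inter> S n True = {}"
proof -
  have "openin X (S n False)" "S n True = topspace X - X closure_of (S n False)"
    using assms unfolding dyadic_subbase_def regular_openin_def by blast+
  then show ?thesis using closure_of_subset[OF openin_subset] by blast
qed

lemma tcode_eq_Some_iff:
  assumes "dyadic_subbase X S"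
  shows "tcode S x n = Some a \<longleftrightarrow> x \<in> S n a"
  using dyadic_disjoint[OF assms, of n] by (cases a) (auto simp: tcode_def)

text \<open>By regularity the exterior relation is symmetric, so a point outside \<open>S n False\<close> and \<open>S n True\<close>
  is a boundary point of both.\<close>

lemma tcode_None_closure:
  assumes S: "dyadic_subbase X S" and x: "x \<in> topspace X" "tcode S x n = None"
  shows "x \<in> X closure_of (S n a)"
proof -
  have ext: "S n True = topspace X - X closure_of (S n False)"
    and reg: "X interior_of (X closure_of (S n False)) = S n False"
    using S unfolding dyadic_subbase_def regular_openin_def by blast+
  have out: "x \<notin> S n False" "x \<notin> S n True" using x(2) by (auto simp: tcode_def split: if_splits)
  have "S n False = topspace X - X closure_of (S n True)"
    using reg unfolding ext by (simp add: interior_of_closure_of)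
  then show ?thesis using ext out x(1) by (cases a) auto
qed

lemma mem_S_cell_tcode:
  assumes "dyadic_subbase X S"
  shows "x \<in> S_cell X S e \<longleftrightarrow> x \<in> topspace X \<and> e \<subseteq>\<^sub>m tcode S x"
proof -
  have "(\<forall>k\<in>dom e. x \<in> S k (the (e k))) \<longleftrightarrow> e \<subseteq>\<^sub>m tcode S x"
    unfolding map_le_def
    by (intro ball_cong refl) (auto simp flip: tcode_eq_Some_iff[OF assms])
  then show ?thesis by (auto simp: S_cell_def)
qed

lemma openin_S_cell:
  assumes "dyadic_subbase X S" "finite (dom e)"
  shows "openin X (S_cell X S e)"
proof -
  have "openin X (S n a)" for n a
    using assms(1) unfolding dyadic_subbase_def regular_openin_def by blast
  then show ?thesis unfolding S_cell_def using assms(2)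
    by (cases "dom e = {}") (auto intro!: openin_Int openin_INT)
qed

text \<open>The cells of the truncated codes of \<open>x\<close> form a neighbourhood base at \<open>x\<close>.\<close>

lemma S_cell_neighbourhood:
  assumes S: "dyadic_subbase X S" and U: "openin X U" "x \<in> U"
  obtains m where "S_cell X S (tcode S x |` {..<m}) \<subseteq> U"
proof -
  let ?P = "\<lambda>U. \<exists>n a. U = S n a"
  have "openin X = arbitrary union_of (finite intersection_of ?P relative_to topspace X)"
    using S istopology_subbase[of ?P "topspace X"] topology_inverse'
    unfolding dyadic_subbase_def by metis
  then have "(arbitrary union_of (finite intersection_of ?P relative_to topspace X)) U"
    using U(1) by simp
  then obtain B where B: "(finite intersection_of ?P relative_to topspace X) B" "x \<in> B" "B \<subseteq> U"
    using U(2) unfolding arbitrary_union_of_alt by blast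
  then obtain \<F> where F: "finite \<F>" "\<F> \<subseteq> Collect ?P" "B = topspace X \<inter> \<Inter>\<F>"
    unfolding relative_to_def intersection_of_def by auto
  have "\<exists>n. \<exists>a. V = S n a" if "V \<in> \<F>" for V using F(2) that by auto
  then obtain idx where idx: "\<And>V. V \<in> \<F> \<Longrightarrow> \<exists>a. V = S (idx V) a" by metis
  obtain m where m: "\<And>V. V \<in> \<F> \<Longrightarrow> idx V < m"
    using finite_nat_set_iff_bounded[of "idx ` \<F>"] F(1) by auto
  have "y \<in> V" if y: "y \<in> S_cell X S (tcode S x |` {..<m})" and V: "V \<in> \<F>" for y V
  proof -
    obtain a where a: "V = S (idx V) a" using idx V by blast
    have "x \<in> V" using B(2) F(3) V by blast
    then have "tcode S x (idx V) = Some a" using a tcode_eq_Some_iff[OF S] by metis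
    then have "(tcode S x |` {..<m}) (idx V) = Some a" using m[OF V] by simp
    then have "tcode S y (idx V) = Some a"
      using y unfolding mem_S_cell_tcode[OF S] map_le_def by (metis domI)
    then show ?thesis using a tcode_eq_Some_iff[OF S] by metis
  qed
  then have "S_cell X S (tcode S x |` {..<m}) \<subseteq> B"
    unfolding F(3) by (auto simp: S_cell_def)
  then show ?thesis using that B(3) by blast
qed

text \<open>Given a nonempty open subset \<open>U\<close> of the cell of \<open>e\<close>, a point whose code, truncated late
  enough for \<open>U\<close>, equals \<open>e\<close> lies in the closure of \<open>U\<close>: in each early coordinate it either carries the entry of \<open>e\<close>, which
  is shared by all points of the cell, or is a boundary point of both sets. Properness turns this
  coordinatewise condition into membership in the closure of a small cell around \<open>u\<close>.\<close>

lemma truncated_code_in_closure: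
  assumes S: "proper_dyadic_subbase X S" and U: "openin X U" "u \<in> U" "U \<subseteq> S_cell X S e"
  obtains m where
    "\<And>n x. m \<le> n \<Longrightarrow> x \<in> topspace X \<Longrightarrow> tcode S x |` {..<n} = e \<Longrightarrow> x \<in> X closure_of U"
proof -
  have dy: "dyadic_subbase X S" using S by (simp add: proper_dyadic_subbase_def)
  obtain m where m: "S_cell X S (tcode S u |` {..<m}) \<subseteq> U"
    using S_cell_neighbourhood[OF dy U(1,2)] .
  let ?d = "tcode S u |` {..<m}"
  have "x \<in> X closure_of U"
    if "m \<le> n" and x: "x \<in> topspace X" and e: "tcode S x |` {..<n} = e" for n x
  proof -
    have "x \<in> X closure_of (S k (the (?d k)))" if k: "k \<in> dom ?d" for k
    proof (cases "tcode S x k")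
      case None
      then show ?thesis using tcode_None_closure[OF dy x] by blast
    next
      case (Some a)
      have "k < m" using k by auto
      then have "e k = Some a" using Some e \<open>m \<le> n\<close> by auto
      moreover have "e \<subseteq>\<^sub>m tcode S u" using U mem_S_cell_tcode[OF dy] by blast
      ultimately have "the (?d k) = a" using \<open>k < m\<close> by (metis domI lessThan_iff map_le_def option.sel restrict_in)
      moreover have "openin X (S k a)"
        using dy unfolding dyadic_subbase_def regular_openin_def by blast
      ultimately show ?thesis
        using Some tcode_eq_Some_iff[OF dy] closure_of_subset[OF openin_subset] by blast
    qed
    then have "x \<in> S_cell_bar X S ?d" using x by (auto simp: S_cell_bar_def)
    moreover have "finite (dom ?d)" by simp
    ultimately have "x \<in> X closure_of (S_cell X S ?d)"
      using S unfolding proper_dyadic_subbase_def by blast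
    then show ?thesis using closure_of_mono[OF m] by blast
  qed
  then show ?thesis using that by blast
qed

lemma tcode_isolated_total:
  assumes S: "dyadic_subbase X S" and x: "openin X {x}"
  shows "tcode S x n \<noteq> None"
proof
  assume None: "tcode S x n = None"
  have "x \<in> topspace X" using openin_subset[OF x] by simp
  then have "x \<in> X closure_of (S n True)" by (rule tcode_None_closure[OF S _ None])
  then have "x \<in> S n True" using x by (auto simp: in_closure_of)
  then show False using None tcode_eq_Some_iff[OF S] by (metis option.distinct(1))
qed

lemma escapes_codes:
  assumes H: "Hausdorff_space X" and na: "strongly_nonadhesive_space X"
    and S: "proper_dyadic_subbase X S"
  shows "escapes (codes X S)"
  unfolding escapes_def
proof (intro allI impI)
  fix e :: tseq assume fin: "finite (dom e)"
  have dy: "dyadic_subbase X S" using S by (simp add: proper_dyadic_subbase_def)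
  let ?E = "S_cell X S e"
  let ?Y = "subtopology X ?E"
  have E: "openin X ?E" by (rule openin_S_cell[OF dy fin])
  have topY: "topspace ?Y = ?E" using openin_subset[OF E] by auto
  have inE: "x \<in> ?E" if "x \<in> topspace X" "tcode S x |` {..<n} = e" for x n
    using that restrict_map_le mem_S_cell_tcode[OF dy] by blast
  have "\<not> adhesive_space ?Y" using na E unfolding strongly_nonadhesive_space_def by blast
  then consider (single) "\<And>x y. x \<in> ?E \<Longrightarrow> y \<in> ?E \<Longrightarrow> x = y"
    | (sep) U V where "openin ?Y U" "openin ?Y V" "U \<noteq> {}" "V \<noteq> {}"
        "?Y closure_of U \<inter> ?Y closure_of V = {}"
    unfolding adhesive_space_def topY using Hausdorff_space_subtopology[OF H] by blast
  then have "\<exists>m. \<forall>n\<ge>m. \<forall>x\<in>topspace X. tcode S x |` {..<n} \<noteq> e"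
  proof cases
    case single
    obtain m where m: "dom e \<subseteq> {..<m}" using fin by (rule finite_dom_bound)
    have "tcode S x |` {..<n} \<noteq> e" if n: "n \<ge> Suc m" and x: "x \<in> topspace X" for n x
    proof
      assume e: "tcode S x |` {..<n} = e"
      then have "?E = {x}" using single inE[OF x e] by blast
      then have "tcode S x m \<noteq> None" using tcode_isolated_total[OF dy] E by metis
      then have "m \<in> dom e" using n e by (auto simp: domIff)
      then show False using m by blast
    qed
    then show ?thesis by blast
  next
    case sep
    obtain u v where uv: "u \<in> U" "v \<in> V" using sep by blast
    have UV: "openin X U" "openin X V" "U \<subseteq> ?E" "V \<subseteq> ?E"
      using sep E openin_open_subtopology by metis+
    obtain m where m: "\<And>n x. m \<le> n \<Longrightarrow> x \<in> topspace X \<Longrightarrow> tcode S x |` {..<n} = e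
        \<Longrightarrow> x \<in> X closure_of U"
      using truncated_code_in_closure[OF S UV(1) uv(1) UV(3)] by blast
    obtain m' where m': "\<And>n x. m' \<le> n \<Longrightarrow> x \<in> topspace X \<Longrightarrow> tcode S x |` {..<n} = e
        \<Longrightarrow> x \<in> X closure_of V"
      using truncated_code_in_closure[OF S UV(2) uv(2) UV(4)] by blast
    have clos: "?E \<inter> X closure_of U \<inter> X closure_of V = {}"
      using sep(5) UV(3,4) by (simp add: closure_of_subtopology inf.absorb2) blast
    have "tcode S x |` {..<n} \<noteq> e" if "n \<ge> max m m'" "x \<in> topspace X" for n x
      using m[of n x] m'[of n x] inE[of x n] that clos by auto
    then show ?thesis by blast
  qed
  then show "\<exists>m. \<forall>m'\<ge>m. \<forall>p\<in>codes X S. p |` {..<m'} \<noteq> e"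
    by (auto simp: codes_def)
qed

text \<open>If \<open>q \<sqsubseteq> p\<close>, then the truncation of \<open>q\<close> at \<open>n\<close> is one of the finitely many sequences below the
  truncation of \<open>p\<close> at \<open>n\<close>.\<close>

lemma escapes_up_closure:
  assumes "escapes C"
  shows "escapes {p. \<exists>q\<in>C. q \<subseteq>\<^sub>m p}"
  unfolding escapes_def
proof (intro allI impI)
  fix e :: tseq assume fin: "finite (dom e)"
  let ?F = "{d. d \<subseteq>\<^sub>m e}"
  have "d = e |` dom d" if "d \<subseteq>\<^sub>m e" for d
    using that by (auto simp: map_le_def restrict_map_def fun_eq_iff domIff)
  then have "?F \<subseteq> (\<lambda>A. e |` A) ` Pow (dom e)"
    using map_le_implies_dom_le by blast
  then have finF: "finite ?F" using fin finite_subset by blast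
  have "\<exists>m. \<forall>n\<ge>m. \<forall>q\<in>C. q |` {..<n} \<noteq> d" if "d \<in> ?F" for d
  proof -
    have "finite (dom d)"
      using that by (intro finite_subset[OF _ fin] map_le_implies_dom_le) simp
    then show ?thesis using assms unfolding escapes_def by blast
  qed
  then obtain b where b: "\<And>d n q. d \<in> ?F \<Longrightarrow> n \<ge> b d \<Longrightarrow> q \<in> C \<Longrightarrow> q |` {..<n} \<noteq> d"
    by metis
  obtain m where m: "\<And>d. d \<in> ?F \<Longrightarrow> b d \<le> m"
    using finite_nat_set_iff_bounded_le[of "b ` ?F"] finF by auto
  have False if "n \<ge> m" "q \<in> C" "q \<subseteq>\<^sub>m p" "p |` {..<n} = e" for n p q
  proof -
    have "q |` {..<n} \<subseteq>\<^sub>m p |` {..<n}"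
      using that(3) by (auto simp: map_le_def restrict_map_def domIff)
    then have d: "q |` {..<n} \<in> ?F" using that(4) by simp
    then show False using b[OF d _ that(2), of n] m[OF d] that(1) by simp
  qed
  then show "\<exists>m. \<forall>m'\<ge>m. \<forall>p\<in>{p. \<exists>q\<in>C. q \<subseteq>\<^sub>m p}. p |` {..<m'} \<noteq> e" by blast
qed

theorem theorem5p11:
  fixes X :: "'a topology" and S :: "nat \<Rightarrow> bool \<Rightarrow> 'a set"
  assumes "topspace X \<noteq> {}"
    and "second_countable X"
    and "Hausdorff_space X"
    and "strongly_nonadhesive_space X"
    and "proper_dyadic_subbase X S"
  shows
    "(enough_minimal_elements (noncompact_elements (D_domain X S)) \<and>
      compactin (L_space (D_domain X S))
        (minimal_elements (noncompact_elements (D_domain X S)))) \<and>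
     (enough_minimal_elements (noncompact_elements (D_hat_domain X S)) \<and>
      compactin (L_space (D_hat_domain X S))
        (minimal_elements (noncompact_elements (D_hat_domain X S))))"
proof -
  have c: "escapes (codes X S)" using escapes_codes assms by blast
  then have u: "escapes (up_codes X S)" unfolding up_codes_def by (rule escapes_up_closure)
  have D: "D_domain X S = Idl (\<subseteq>\<^sub>m) (truncations (codes X S))"
    and D_hat: "D_hat_domain X S = Idl (\<subseteq>\<^sub>m) (truncations (up_codes X S))"
    by (simp_all add: D_domain_def D_hat_domain_def K_poset_def K_hat_poset_def truncations_def)
  show ?thesis
    unfolding D D_hat
    using enough_minimal_noncompact[OF c] compactin_minimal_noncompact[OF c]
      enough_minimal_noncompact[OF u] compactin_minimal_noncompact[OF u]
    by blast
qed

end
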